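(* Let $f:\{0,1\}^n\to\{-1,1\}$ and let $\mathcal S$ be a collection of sets $S\subseteq[n]$ with $\hat f(S)\ne0$ for all $S\in\mathcal S$. Suppose $\sum_{S\in\mathcal S}|\hat f(S)|\le1-\delta$ and $\max_{S\notin\mathcal S}|\hat f(S)|\le c$. Then $sr(f\circ\mathsf{XOR})\ge\delta/c$.
   Context: Fourier expansion: $\chi_S(x)=(-1)^{\sum_{i\in S}x_i}$ and $\hat f(S)=\mathbb{E}_{x\in\{0,1\}^n}[f(x)\chi_S(x)]$ (uniform $x$), so $f=\sum_S\hat f(S)\chi_S$. $f\circ\mathsf{XOR}$ has the $2^n\times2^n$ communication matrix $M_{x,y}=f(x\oplus y)$. The sign rank of a real matrix $M$ with no zero entries is $sr(M)=\min\{\mathrm{rank}(B):\mathrm{sgn}(B_{ij})=\mathrm{sgn}(M_{ij})\ \forall i,j\}$. *)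

theory Defs
  imports "HOL-Analysis.Analysis"
begin

text \<open>The cube \<open>{0,1}\<^sup>n\<close> is the type \<^typ>\<open>bool ^ 'n\<close> with \<open>n = CARD('n)\<close>; the index set \<open>[n]\<close>
  is \<open>UNIV :: 'n set\<close>.\<close>

definition character :: "'n::finite set \<Rightarrow> bool ^ 'n \<Rightarrow> real" where
  "character S x = (-1) ^ (\<Sum>i\<in>S. of_bool (x $ i))"

definition fourier_coeff :: "(bool ^ 'n::finite \<Rightarrow> real) \<Rightarrow> 'n set \<Rightarrow> real" where
  "fourier_coeff f S = (\<Sum>x\<in>UNIV. f x * character S x) / 2 ^ CARD('n)"

definition xor_vec :: "bool ^ 'n::finite \<Rightarrow> bool ^ 'n \<Rightarrow> bool ^ 'n" where
  "xor_vec x y = (\<chi> i. x $ i \<noteq> y $ i)"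

definition xor_matrix :: "(bool ^ 'n::finite \<Rightarrow> real) \<Rightarrow> real ^ (bool ^ 'n) ^ (bool ^ 'n)" where
  "xor_matrix f = (\<chi> x y. f (xor_vec x y))"

text \<open>Only meaningful for matrices without zero entries. The minimum is attained, since \<open>B = M\<close> is
  always admissible.\<close>

definition sign_rank :: "real ^ 'c::finite ^ 'r::finite \<Rightarrow> nat" where
  "sign_rank M = (LEAST r. \<exists>B :: real ^ 'c ^ 'r.
     (\<forall>i j. sgn (B $ i $ j) = sgn (M $ i $ j)) \<and> rank B = r)"

end

theory Submission
  imports Defs
begin

text \<open>Forster's method, in a form that needs no general position.  Let \<open>B\<close> have rank \<open>r\<close> and
  nonzero entries, and write \<open>B $ i $ j = u\<^sub>i \<bullet> e\<^sub>j\<close> with \<open>u\<^sub>i\<close> the rows of \<open>B\<close>.  For weights \<open>w\<close> in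
  the simplex and \<open>\<epsilon> > 0\<close> let \<open>S\<^sub>w = \<Sum>\<^sub>k w\<^sub>k u\<^sub>k u\<^sub>k\<^sup>T + \<epsilon> I\<close>.  Since \<open>\<Sum>\<^sub>k w\<^sub>k (u\<^sub>k \<bullet> S\<^sub>w\<inverse> u\<^sub>k) \<le> r\<close>,
  a Brouwer fixed point of \<open>w \<mapsto>\<close> normalised \<open>1 / (u\<^sub>i \<bullet> S\<^sub>w\<inverse> u\<^sub>i)\<close> balances all the summands, so that
  each is at most \<open>r / N\<close>.  Rescaling the \<open>u\<^sub>i\<close> and \<open>e\<^sub>j\<close> to unit length for the forms \<open>S\<^sub>w\<inverse>\<close> and
  \<open>S\<^sub>w\<close> gives unit vectors \<open>a\<^sub>i\<close>, \<open>b\<^sub>j\<close> whose Gram matrix has the signs of \<open>B\<close> and mean square at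
  least \<open>(1 - \<eta>) / r\<close>, where \<open>\<eta> \<rightarrow> 0\<close> with \<open>\<epsilon>\<close>.

  Now let \<open>B\<close> realise the signs of \<open>f \<circ> XOR\<close>, and remove the characters in \<open>\<S>\<close> from \<open>f\<close>.  What
  remains agrees in sign with \<open>f\<close> and has modulus at least \<open>\<delta>\<close>, while its XOR matrix has spectral
  norm at most \<open>c N\<close>.  Pairing that matrix with \<open>a\<^sub>i \<bullet> b\<^sub>j\<close> gives \<open>\<delta> (1 - \<eta>) N\<^sup>2 / r \<le> c N\<^sup>2\<close>.\<close>

section \<open>Balancing weights\<close>

text \<open>This is \<open>S\<^sub>w\<close> as a map on vectors. For \<open>0 < e\<close> the last
  term keeps it positive definite on the simplex even where weights vanish or the \<open>u k\<close>
  do not span.\<close>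

definition frame_op :: "('r::finite \<Rightarrow> 'v::euclidean_space) \<Rightarrow> real \<Rightarrow> real ^ 'r \<Rightarrow> 'v \<Rightarrow> 'v" where
  "frame_op u e w x = (\<Sum>k\<in>UNIV. (w $ k * (u k \<bullet> x)) *\<^sub>R u k) + e *\<^sub>R x"

definition prob_simplex :: "(real ^ 'r::finite) set" where
  "prob_simplex = {w. (\<forall>i. 0 \<le> w $ i) \<and> (\<Sum>i\<in>UNIV. w $ i) = 1}"

lemma linear_frame_op: "linear (frame_op u e w)"
  unfolding frame_op_def
  by (intro linearI)
    (simp_all add: inner_add_right algebra_simps sum.distrib scaleR_sum_right)

lemma inner_frame_op:
  "x \<bullet> frame_op u e w y = (\<Sum>k\<in>UNIV. w $ k * (u k \<bullet> x) * (u k \<bullet> y)) + e * (x \<bullet> y)"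
  by (simp add: frame_op_def inner_add_right inner_sum_right algebra_simps inner_commute)

lemma inner_frame_op_commute: "x \<bullet> frame_op u e w y = frame_op u e w x \<bullet> y"
  unfolding inner_commute[of "frame_op u e w x" y] inner_frame_op
  by (simp add: mult_ac inner_commute)

lemma inner_frame_op_ge:
  assumes "w \<in> prob_simplex"
  shows "e * (x \<bullet> x) \<le> x \<bullet> frame_op u e w x"
  using assms unfolding inner_frame_op prob_simplex_def
  by (auto intro!: sum_nonneg simp: mult.assoc)

text \<open>Cauchy-Schwarz applied to the bound on the quadratic form. The constant is uniform in
  \<open>w\<close>, so for \<open>0 < e\<close> it gives both invertibility and continuity of the
  inverse in \<open>w\<close>.\<close>

lemma norm_frame_op_ge:
  assumes "w \<in> prob_simplex"
  shows "e * norm x \<le> norm (frame_op u e w x)"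
proof (cases "x = 0")
  case False
  have "e * norm x * norm x \<le> norm (frame_op u e w x) * norm x"
    using inner_frame_op_ge[OF assms, of e x u] norm_cauchy_schwarz[of x "frame_op u e w x"]
    by (simp add: dot_square_norm power2_eq_square mult_ac)
  then show ?thesis using False by simp
qed auto

lemma inj_frame_op:
  assumes "w \<in> prob_simplex" "0 < e"
  shows "inj (frame_op u e w)"
proof -
  have "x = 0" if "frame_op u e w x = 0" for x
    using norm_frame_op_ge[OF assms(1), of e x u] that assms(2) by (simp add: mult_le_0_iff)
  then show ?thesis using linear_injective_0[OF linear_frame_op] by blast
qed

lemma frame_op_inv:
  assumes "w \<in> prob_simplex" "0 < e"
  shows "frame_op u e w (inv (frame_op u e w) y) = y"
  using linear_injective_imp_surjective[OF linear_frame_op inj_frame_op[OF assms] refl]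
  by (rule surj_f_inv_f)

lemma inv_frame_op:
  assumes "w \<in> prob_simplex" "0 < e"
  shows "inv (frame_op u e w) (frame_op u e w y) = y"
  by (rule inv_f_f[OF inj_frame_op[OF assms]])

lemma inner_inv_frame_op_pos:
  assumes "w \<in> prob_simplex" "0 < e" "y \<noteq> 0"
  shows "0 < y \<bullet> inv (frame_op u e w) y"
proof -
  let ?x = "inv (frame_op u e w) y"
  have "?x \<noteq> 0"
    using frame_op_inv[OF assms(1,2), of u y] linear_0[OF linear_frame_op[of u e w]] assms(3)
    by metis
  then have "0 < e * (?x \<bullet> ?x)" using assms(2) by simp
  also have "\<dots> \<le> ?x \<bullet> y"
    using inner_frame_op_ge[OF assms(1), of e ?x u] frame_op_inv[OF assms(1,2)] by metis
  finally show ?thesis by (simp add: inner_commute)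
qed

lemma continuous_on_inv_frame_op:
  fixes u :: "'r::finite \<Rightarrow> 'v::euclidean_space"
  assumes "0 < e"
  shows "continuous_on prob_simplex (\<lambda>w. inv (frame_op u e w) y)"
  unfolding continuous_on_def
proof
  fix v :: "real ^ 'r" assume v: "v \<in> prob_simplex"
  let ?x = "\<lambda>w. inv (frame_op u e w) y"
  let ?g = "\<lambda>w. norm (frame_op u e v (?x v) - frame_op u e w (?x v)) / e"
  have "continuous_on UNIV ?g"
    unfolding frame_op_def by (intro continuous_intros) (use assms in auto)
  then have "(?g \<longlongrightarrow> ?g v) (at v within prob_simplex)"
    using continuous_on_subset[OF _ subset_UNIV] v by (metis continuous_on_def)
  then have g: "(?g \<longlongrightarrow> 0) (at v within prob_simplex)" by simp
  have "norm (?x w - ?x v) \<le> ?g w" if w: "w \<in> prob_simplex" for w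
  proof -
    have "e * norm (?x w - ?x v) \<le> norm (frame_op u e w (?x w - ?x v))"
      by (rule norm_frame_op_ge[OF w])
    \<comment> \<open>Both solutions are mapped to the same \<open>y\<close>, so the difference is
      expressed through the fixed vector \<open>?x v\<close>, on which the operator varies
      continuously with \<open>w\<close>.\<close>
    also have "frame_op u e w (?x w - ?x v) = frame_op u e v (?x v) - frame_op u e w (?x v)"
      using frame_op_inv[OF w assms, of u] frame_op_inv[OF v assms, of u]
      by (simp add: linear_diff[OF linear_frame_op])
    finally show ?thesis using assms by (simp add: field_simps)
  qed
  then have "\<forall>\<^sub>F w in at v within prob_simplex. norm (?x w - ?x v) \<le> ?g w"
    by (auto simp: eventually_at_filter)
  from Lim_null_comparison[OF this g]
  show "(?x \<longlongrightarrow> ?x v) (at v within prob_simplex)"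
    by (simp add: LIM_zero_iff)
qed

text \<open>The residual of the expansion is orthogonal to \<open>B\<close> but lies in its span,
  hence is orthogonal to itself and vanishes.\<close>

lemma orthonormal_inner_expansion:
  fixes B :: "'v::euclidean_space set"
  assumes "pairwise orthogonal B" "\<And>b. b \<in> B \<Longrightarrow> norm b = 1" "x \<in> span B"
  shows "x \<bullet> y = (\<Sum>b\<in>B. (x \<bullet> b) * (b \<bullet> y))"
proof -
  have fin: "finite B" using assms(1) pairwise_orthogonal_imp_finite by blast
  let ?z = "\<Sum>b\<in>B. (x \<bullet> b) *\<^sub>R b"
  have "(x - ?z) \<bullet> c = 0" if c: "c \<in> B" for c
  proof -
    have "?z \<bullet> c = (\<Sum>b\<in>B. if b = c then x \<bullet> c else 0)"
      unfolding inner_sum_left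
    proof (rule sum.cong[OF refl])
      fix b assume "b \<in> B"
      show "(x \<bullet> b) *\<^sub>R b \<bullet> c = (if b = c then x \<bullet> c else 0)"
        using assms(1,2) c \<open>b \<in> B\<close>
        by (auto simp: pairwise_def orthogonal_def dot_square_norm)
    qed
    then show ?thesis using fin c by (simp add: inner_diff_left)
  qed
  moreover have "x - ?z \<in> span B"
    by (intro span_diff assms(3) span_sum span_scale span_base)
  ultimately have "orthogonal (x - ?z) (x - ?z)"
    by (intro orthogonal_to_span[of "x - ?z" B]) (auto simp: orthogonal_def)
  then have "x = ?z" by (simp add: orthogonal_self)
  then have "x \<bullet> y = ?z \<bullet> y" by simp
  then show ?thesis by (simp add: inner_sum_left)
qed

text \<open>The left-hand side is the trace of \<open>S\<^sub>w\<inverse> (S\<^sub>w - \<epsilon> I)\<close>, computed in an orthonormal basis of the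
  span of the \<open>u\<^sub>k\<close>.\<close>

lemma sum_weighted_leverage_le_dim:
  fixes u :: "'r::finite \<Rightarrow> 'v::euclidean_space"
  assumes w: "w \<in> prob_simplex" and e: "0 < e"
  shows "(\<Sum>k\<in>UNIV. w $ k * (u k \<bullet> inv (frame_op u e w) (u k))) \<le> dim (range u)"
proof -
  let ?Q = "inv (frame_op u e w)"
  obtain B where B: "pairwise orthogonal B" "\<And>b. b \<in> B \<Longrightarrow> norm b = 1"
      "card B = dim (span (range u))" "span B = span (range u)"
    using orthonormal_basis_subspace[OF subspace_span[of "range u"]] by metis
  have "(\<Sum>k\<in>UNIV. w $ k * (u k \<bullet> ?Q (u k)))
      = (\<Sum>k\<in>UNIV. \<Sum>b\<in>B. w $ k * ((u k \<bullet> b) * (b \<bullet> ?Q (u k))))"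
    using orthonormal_inner_expansion[OF B(1,2)] B(4)
    by (simp add: sum_distrib_left span_base)
  also have "\<dots> = (\<Sum>b\<in>B. \<Sum>k\<in>UNIV. w $ k * ((u k \<bullet> b) * (b \<bullet> ?Q (u k))))"
    by (rule sum.swap)
  also have "\<dots> \<le> (\<Sum>b\<in>B. 1)"
  proof (rule sum_mono)
    fix b assume b: "b \<in> B"
    have sym: "b \<bullet> ?Q y = ?Q b \<bullet> y" for y
      using inner_frame_op_commute[of "?Q b" u e w "?Q y"] frame_op_inv[OF w e, of u] by simp
    \<comment> \<open>Summing over \<open>k\<close> rebuilds the operator without its
      \<open>e\<close> term. The diagonal entry of the trace is thus 1 minus a positive
      quantity.\<close>
    have "(\<Sum>k\<in>UNIV. w $ k * ((u k \<bullet> b) * (b \<bullet> ?Q (u k))))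
        = ?Q b \<bullet> (frame_op u e w b - e *\<^sub>R b)"
      by (simp add: sym frame_op_def inner_sum_right mult_ac)
    also have "\<dots> = b \<bullet> b - e * (?Q b \<bullet> b)"
      using sym[of "frame_op u e w b"] inv_frame_op[OF w e, of u] by (simp add: inner_diff_right)
    also have "\<dots> \<le> 1"
    proof -
      have "b \<bullet> b = 1" using B(2)[OF b] by (simp add: dot_square_norm)
      moreover from this have "b \<noteq> 0" by auto
      ultimately show ?thesis
        using inner_inv_frame_op_pos[OF w e, of b u] e by (simp add: inner_commute)
    qed
    finally show "(\<Sum>k\<in>UNIV. w $ k * ((u k \<bullet> b) * (b \<bullet> ?Q (u k)))) \<le> 1" .
  qed
  also have "\<dots> = dim (range u)" using B(3) by simp
  finally show ?thesis .
qed

lemma convex_prob_simplex: "convex prob_simplex"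
  unfolding convex_def prob_simplex_def
  by (auto simp: sum.distrib sum_distrib_left[symmetric])

lemma compact_prob_simplex: "compact (prob_simplex :: (real ^ 'r::finite) set)"
  unfolding compact_eq_bounded_closed
proof
  have "norm w \<le> 1" if "w \<in> prob_simplex" for w :: "real ^ 'r"
    using norm_le_l1_cart[of w] that by (simp add: prob_simplex_def)
  then show "bounded (prob_simplex :: (real ^ 'r) set)" unfolding bounded_iff by blast
  show "closed (prob_simplex :: (real ^ 'r) set)"
    unfolding prob_simplex_def
    by (intro closed_Collect_conj closed_Collect_all closed_Collect_le closed_Collect_eq
        continuous_intros)
qed

lemma prob_simplex_nonempty: "prob_simplex \<noteq> ({} :: (real ^ 'r::finite) set)"
proof -
  have "(\<chi> i. 1 / real CARD('r)) \<in> (prob_simplex :: (real ^ 'r) set)"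
    by (simp add: prob_simplex_def)
  then show ?thesis by blast
qed

lemma ex_balancing_weights:
  fixes u :: "'r::finite \<Rightarrow> 'v::euclidean_space"
  assumes u: "\<And>i. u i \<noteq> 0" and e: "0 < e"
  obtains w where "w \<in> prob_simplex"
    and "\<And>i. real CARD('r) * (w $ i * (u i \<bullet> inv (frame_op u e w) (u i))) \<le> dim (range u)"
proof -
  define D where "D w i = u i \<bullet> inv (frame_op u e w) (u i)" for w i
  define T where "T w = (\<Sum>i\<in>UNIV. 1 / D w i)" for w
  define G where "G w = (\<chi> i. 1 / D w i / T w)" for w
  \<comment> \<open>Positivity holds on the whole simplex, boundary included, so \<open>G\<close> is
    a continuous self-map of it.\<close>
  have D: "0 < D w i" if "w \<in> prob_simplex" for w i
    unfolding D_def by (rule inner_inv_frame_op_pos[OF that e u])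
  have T: "0 < T w" if "w \<in> prob_simplex" for w
    unfolding T_def using D[OF that] by (intro sum_pos) auto
  have D0: "\<forall>w\<in>prob_simplex. D w i \<noteq> 0" for i using D by (metis less_irrefl)
  have T0: "\<forall>w\<in>prob_simplex. T w \<noteq> 0" using T by (metis less_irrefl)
  have contD: "continuous_on prob_simplex (\<lambda>w. D w i)" for i
    unfolding D_def by (intro continuous_intros continuous_on_inv_frame_op e)
  have "continuous_on prob_simplex T"
    unfolding T_def by (intro continuous_intros contD) (use D0 in auto)
  then have "continuous_on prob_simplex G"
    unfolding G_def
    by (intro continuous_intros contD) (use D0 T0 in auto)
  moreover have "G \<in> prob_simplex \<rightarrow> prob_simplex"
  proof
    fix w :: "real ^ 'r" assume w: "w \<in> prob_simplex"
    have "(\<Sum>i\<in>UNIV. 1 / D w i / T w) = 1"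
      unfolding sum_divide_distrib[symmetric] T_def[symmetric] using T[OF w] by simp
    then show "G w \<in> prob_simplex"
      using D[OF w] T[OF w] by (simp add: prob_simplex_def G_def less_imp_le)
  qed
  ultimately obtain w where w: "w \<in> prob_simplex" and fixed: "G w = w"
    using brouwer[OF compact_prob_simplex convex_prob_simplex prob_simplex_nonempty] by metis
  have wD: "w $ i * D w i = 1 / T w" for i
  proof -
    have "w $ i = 1 / D w i / T w" using fixed unfolding G_def by (metis vec_lambda_beta)
    then show ?thesis using D[OF w, of i] by (metis divide_divide_eq_left' less_irrefl
      mult.commute nonzero_mult_div_cancel_left times_divide_eq_right)
  qed
  \<comment> \<open>At the fixed point all summands equal \<open>1 / T w\<close>, so
    \<open>CARD('r)\<close> copies of one make up the whole trace.\<close>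
  have "real CARD('r) * (w $ i * D w i) = (\<Sum>k\<in>UNIV. w $ k * D w k)" for i
    by (simp add: wD)
  also have "(\<Sum>k\<in>UNIV. w $ k * D w k) \<le> dim (range u)"
    unfolding D_def by (rule sum_weighted_leverage_le_dim[OF w e])
  finally show thesis using that[OF w] unfolding D_def by blast
qed

section \<open>Unit vectors realising the signs of a low-rank matrix\<close>

text \<open>A square root of the form \<open>x \<bullet> S\<^sub>w y\<close>.\<close>

definition frame_embed ::
  "('r::finite \<Rightarrow> 'v::euclidean_space) \<Rightarrow> real \<Rightarrow> real ^ 'r \<Rightarrow> 'v \<Rightarrow> (real ^ 'r) \<times> 'v" where
  "frame_embed u e w x = ((\<chi> k. sqrt (w $ k) * (u k \<bullet> x)), sqrt e *\<^sub>R x)"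

lemma inner_frame_embed:
  assumes "w \<in> prob_simplex" "0 < e"
  shows "frame_embed u e w x \<bullet> frame_embed u e w y = x \<bullet> frame_op u e w y"
proof -
  have "sqrt (w $ k) * (u k \<bullet> x) * (sqrt (w $ k) * (u k \<bullet> y)) = w $ k * (u k \<bullet> x) * (u k \<bullet> y)" for k
  proof -
    have "sqrt (w $ k) * sqrt (w $ k) = w $ k" using assms(1) by (simp add: prob_simplex_def)
    then show ?thesis by (metis mult.assoc mult.left_commute)
  qed
  moreover have "sqrt e * (sqrt e * z) = e * z" for z
    using assms(2) by (simp flip: mult.assoc)
  ultimately show ?thesis
    unfolding inner_frame_op frame_embed_def inner_vec_def inner_prod_def
    by (simp only: fst_conv snd_conv vec_lambda_beta inner_real_def inner_scaleR_left inner_scaleR_right)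
qed

lemma ex_unit_vectors_of_rank:
  fixes B :: "real ^ 'c::finite ^ 'r::finite"
  assumes nz: "\<And>i j. B $ i $ j \<noteq> 0" and \<eta>: "0 < \<eta>"
  obtains a b :: "_ \<Rightarrow> (real ^ 'r) \<times> (real ^ 'c)"
  where "\<And>i. norm (a i) = 1" "\<And>j. norm (b j) = 1"
    and "\<And>i j. sgn (a i \<bullet> b j) = sgn (B $ i $ j)"
    and "(1 - \<eta>) * (real CARD('r) * real CARD('c))
      \<le> real (rank B) * (\<Sum>i\<in>UNIV. \<Sum>j\<in>UNIV. (a i \<bullet> b j)\<^sup>2)"
proof -
  define m where "m = Min (range (\<lambda>(i, j). (B $ i $ j)\<^sup>2))"
  have m_le: "m \<le> (B $ i $ j)\<^sup>2" for i j
    unfolding m_def by (rule Min_le) (auto intro: range_eqI[where x="(i, j)"])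
  have m_pos: "0 < m"
    unfolding m_def using nz by (subst Min_gr_iff) auto
  \<comment> \<open>Every \<open>q j\<close> below is at least the least squared entry
    \<open>m\<close>, so this choice makes the \<open>e\<close> term at most a fraction \<eta> of
    \<open>q j\<close>.\<close>
  define e where "e = \<eta> * m"
  have e: "0 < e" using \<eta> m_pos by (simp add: e_def)
  have row_nz: "B $ i \<noteq> 0" for i using nz[of i undefined] by auto
  obtain w where w: "w \<in> prob_simplex"
    and bal: "\<And>i. real CARD('r) * (w $ i * (B $ i \<bullet> inv (frame_op (($) B) e w) (B $ i)))
        \<le> dim (range (($) B))"
    using ex_balancing_weights[of "($) B", OF row_nz e] by metis
  have rank: "dim (range (($) B)) = rank B"
  proof -
    have "rows B = range (($) B)" by (auto simp: rows_def row_def vec_lambda_eta)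
    then show ?thesis by (simp add: row_rank_def)
  qed
  define S where "S = frame_op (($) B) e w"
  define L where "L = frame_embed (($) B) e w"
  define x where "x i = inv S (B $ i)" for i
  define v where "v j = (axis j 1 :: real ^ 'c)" for j
  define D where "D i = B $ i \<bullet> x i" for i
  define q where "q j = v j \<bullet> S (v j)" for j
  have LL: "L y \<bullet> L z = y \<bullet> S z" for y z
    unfolding L_def S_def by (rule inner_frame_embed[OF w e])
  have Sx: "S (x i) = B $ i" for i
    unfolding S_def x_def by (rule frame_op_inv[OF w e])
  have D_pos: "0 < D i" for i
    unfolding D_def x_def S_def by (rule inner_inv_frame_op_pos[OF w e row_nz])
  have Bv: "B $ i \<bullet> v j = B $ i $ j" for i j
    by (simp add: v_def inner_axis)
  have q_eq: "q j = (\<Sum>k\<in>UNIV. w $ k * (B $ k $ j)\<^sup>2) + e" for j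
    unfolding q_def S_def inner_frame_op
    by (simp add: Bv power2_eq_square mult.assoc) (simp add: v_def inner_axis)
  have q_ge: "m \<le> q j" for j
  proof -
    have "m = (\<Sum>k\<in>UNIV. w $ k * m)"
      using w by (simp add: prob_simplex_def flip: sum_distrib_right)
    also have "\<dots> \<le> (\<Sum>k\<in>UNIV. w $ k * (B $ k $ j)\<^sup>2)"
      using w by (intro sum_mono mult_left_mono m_le) (simp add: prob_simplex_def)
    finally show ?thesis using e by (simp add: q_eq)
  qed
  have q_pos: "0 < q j" for j using q_ge[of j] m_pos by linarith
  \<comment> \<open>Applying the inverse operator on the row side only makes \<open>L (x i)\<close>
    and \<open>L (v j)\<close> pair to exactly \<open>B $ i $ j\<close>; the positive scalings then
    preserve signs.\<close>
  define a where "a i = (1 / sqrt (D i)) *\<^sub>R L (x i)" for i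
  define b where "b j = (1 / sqrt (q j)) *\<^sub>R L (v j)" for j
  have ab: "a i \<bullet> b j = B $ i $ j / (sqrt (D i) * sqrt (q j))" for i j
  proof -
    have "L (x i) \<bullet> L (v j) = B $ i $ j"
      using LL[of "v j" "x i"] Bv[of i j] by (simp add: Sx inner_commute)
    then show ?thesis by (simp add: a_def b_def)
  qed
  have na: "norm (a i) = 1" for i
    unfolding a_def norm_eq_sqrt_inner
    using LL[of "x i" "x i"] D_pos[of i] by (simp add: Sx D_def inner_commute)
  have nb: "norm (b j) = 1" for j
    unfolding b_def norm_eq_sqrt_inner
    using LL[of "v j" "v j"] q_pos[of j] by (simp add: q_def)
  have sg: "sgn (a i \<bullet> b j) = sgn (B $ i $ j)" for i j
    using D_pos[of i] q_pos[of j] by (simp add: ab sgn_divide sgn_mult)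
  have sq: "(a i \<bullet> b j)\<^sup>2 = (B $ i $ j)\<^sup>2 / (D i * q j)" for i j
    using D_pos[of i] q_pos[of j] by (simp add: ab power_divide power_mult_distrib)
  have col: "(1 - \<eta>) * real CARD('r) \<le> real (rank B) * (\<Sum>i\<in>UNIV. (a i \<bullet> b j)\<^sup>2)" for j
  proof -
    have "(1 - \<eta>) * q j \<le> q j - e"
      using q_ge[of j] \<eta> by (simp add: e_def algebra_simps)
    then have "(1 - \<eta>) * real CARD('r) \<le> real CARD('r) * ((q j - e) / q j)"
      using q_pos[of j] by (simp add: field_simps)
    also have "\<dots> = (\<Sum>i\<in>UNIV. real CARD('r) * (w $ i * (B $ i $ j)\<^sup>2) / q j)"
      by (simp add: q_eq sum_divide_distrib sum_distrib_left)
    also have "\<dots> \<le> (\<Sum>i\<in>UNIV. real (rank B) * (a i \<bullet> b j)\<^sup>2)"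
    proof (rule sum_mono)
      fix i
      \<comment> \<open>Balance bounds the weight \<open>w $ i\<close> by
        \<open>rank B / (CARD('r) * D i)\<close>, and \<open>1 / D i\<close> is the normalisation
        occurring in the square of \<open>a i \<bullet> b j\<close>.\<close>
      have "real CARD('r) * (w $ i * D i) \<le> rank B"
        using bal[of i] rank by (simp add: D_def x_def S_def)
      then have "real CARD('r) * (w $ i * D i) * ((B $ i $ j)\<^sup>2 / (D i * q j))
          \<le> rank B * ((B $ i $ j)\<^sup>2 / (D i * q j))"
        using D_pos[of i] q_pos[of j] by (intro mult_right_mono) auto
      then show "real CARD('r) * (w $ i * (B $ i $ j)\<^sup>2) / q j \<le> rank B * (a i \<bullet> b j)\<^sup>2"
        using D_pos[of i] by (simp add: sq field_simps)
    qed
    finally show ?thesis by (simp add: sum_distrib_left)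
  qed
  have "(1 - \<eta>) * (real CARD('r) * real CARD('c)) = (\<Sum>j::'c\<in>UNIV. (1 - \<eta>) * real CARD('r))"
    by simp
  also have "\<dots> \<le> (\<Sum>j\<in>UNIV. real (rank B) * (\<Sum>i\<in>UNIV. (a i \<bullet> b j)\<^sup>2))"
    by (intro sum_mono col)
  also have "\<dots> = real (rank B) * (\<Sum>i\<in>UNIV. \<Sum>j\<in>UNIV. (a i \<bullet> b j)\<^sup>2)"
    by (simp add: sum_distrib_left[symmetric] sum.swap[of _ "UNIV :: 'r set"])
  finally show thesis using that[OF na nb sg] by blast
qed

section \<open>Fourier analysis on the cube\<close>

lemma character_eq_prod: "character S x = (\<Prod>i\<in>S. if x $ i then -1 else 1)"
  unfolding character_def power_sum by (intro prod.cong) auto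

lemma character_xor_vec: "character S (xor_vec x y) = character S x * character S y"
  unfolding character_eq_prod prod.distrib[symmetric] xor_vec_def
  by (intro prod.cong) auto

lemma abs_character: "\<bar>character S x\<bar> = 1"
  by (simp add: character_def power_abs)

text \<open>Summing over all \<open>S\<close> factors into a product over coordinates of one plus a
  sign; any coordinate where \<open>x\<close> and \<open>y\<close> differ contributes a zero
  factor.\<close>

lemma sum_character_mult:
  fixes x y :: "bool ^ 'n::finite"
  shows "(\<Sum>S\<in>UNIV. character S x * character S y) = (if x = y then 2 ^ CARD('n) else 0)"
proof -
  have "(\<Sum>S\<in>UNIV. character S x * character S y)
      = (\<Prod>i\<in>UNIV. (if xor_vec x y $ i then -1 else 1) + (1::real))"
    unfolding character_xor_vec[symmetric] by (subst prod_add) (simp_all add: character_eq_prod)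
  also have "\<dots> = (if x = y then 2 ^ CARD('n) else 0)"
  proof (cases "x = y")
    case False
    then obtain i where "x $ i \<noteq> y $ i" by (auto simp: vec_eq_iff)
    then have "xor_vec x y $ i" by (simp add: xor_vec_def)
    then show ?thesis using False by (auto intro!: bexI[of _ i])
  qed (simp add: xor_vec_def)
  finally show ?thesis .
qed

lemma fourier_inversion: "f x = (\<Sum>S\<in>UNIV. fourier_coeff f S * character S x)"
  for f :: "bool ^ 'n::finite \<Rightarrow> real"
proof -
  have "(\<Sum>S\<in>UNIV. fourier_coeff f S * character S x)
      = (\<Sum>S\<in>UNIV. \<Sum>y\<in>UNIV. f y * (character S y * character S x)) / 2 ^ CARD('n)"
    unfolding sum_divide_distrib fourier_coeff_def sum_distrib_right
    by (intro sum.cong refl) simp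
  also have "\<dots> = (\<Sum>y\<in>UNIV. \<Sum>S\<in>UNIV. f y * (character S y * character S x)) / 2 ^ CARD('n)"
    by (subst sum.swap) simp
  also have "\<dots> = (\<Sum>y\<in>UNIV. f y * (if y = x then 2 ^ CARD('n) else 0)) / 2 ^ CARD('n)"
    by (simp add: sum_distrib_left[symmetric] sum_character_mult)
  also have "\<dots> = f x" by (simp add: if_distrib[of "(*) _"] cong: if_cong)
  finally show ?thesis by simp
qed

lemma inner_sum_sum: "sum f A \<bullet> sum g B = (\<Sum>x\<in>A. \<Sum>y\<in>B. f x \<bullet> g y)"
  by (subst inner_sum_left) (simp only: inner_sum_right)

text \<open>Stated for vector values so that it applies directly to the families of unit vectors; it
  follows by expanding the squares and using orthogonality in \<open>S\<close>.\<close>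

lemma parseval_vector:
  fixes a :: "bool ^ 'n::finite \<Rightarrow> 'v::real_inner"
  shows "(\<Sum>S\<in>UNIV. (norm (\<Sum>x\<in>UNIV. character S x *\<^sub>R a x))\<^sup>2)
    = 2 ^ CARD('n) * (\<Sum>x\<in>UNIV. (norm (a x))\<^sup>2)"
proof -
  have "(\<Sum>S\<in>UNIV. (norm (\<Sum>x\<in>UNIV. character S x *\<^sub>R a x))\<^sup>2)
      = (\<Sum>S\<in>UNIV. \<Sum>x\<in>UNIV. \<Sum>y\<in>UNIV. (character S x * character S y) * (a x \<bullet> a y))"
    unfolding power2_norm_eq_inner inner_sum_sum by (simp add: mult_ac)
  also have "\<dots> = (\<Sum>x\<in>UNIV. \<Sum>S\<in>UNIV. \<Sum>y\<in>UNIV. (character S x * character S y) * (a x \<bullet> a y))"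
    by (rule sum.swap)
  also have "\<dots> = (\<Sum>x\<in>UNIV. \<Sum>y\<in>UNIV. \<Sum>S\<in>UNIV. (character S x * character S y) * (a x \<bullet> a y))"
    by (intro sum.cong refl sum.swap)
  also have "\<dots> = (\<Sum>x\<in>UNIV. \<Sum>y\<in>UNIV. if x = y then 2 ^ CARD('n) * (a x \<bullet> a y) else 0)"
    by (simp add: sum_distrib_right[symmetric] sum_character_mult if_distrib[of "\<lambda>z. z * _"] 
        cong: if_cong)
  also have "\<dots> = 2 ^ CARD('n) * (\<Sum>x\<in>UNIV. (norm (a x))\<^sup>2)"
    by (simp add: power2_norm_eq_inner sum_distrib_left)
  finally show ?thesis .
qed

text \<open>The XOR matrix of \<open>g = \<Sum>\<^sub>S g\<^sub>S \<chi>\<^sub>S\<close> is diagonalised by the characters, with eigenvalues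
  \<open>2\<^sup>n g\<^sub>S\<close>.\<close>

lemma xor_pairing_le:
  fixes a b :: "bool ^ 'n::finite \<Rightarrow> 'v::real_inner"
  assumes a: "\<And>x. norm (a x) = 1" and b: "\<And>x. norm (b x) = 1"
    and g: "\<And>S. \<bar>g S\<bar> \<le> c"
  shows "(\<Sum>x\<in>UNIV. \<Sum>y\<in>UNIV. (\<Sum>S\<in>UNIV. g S * character S (xor_vec x y)) * (a x \<bullet> b y))
    \<le> c * (2 ^ CARD('n) * 2 ^ CARD('n))"
proof -
  define N :: real where "N = 2 ^ CARD('n)"
  have c: "0 \<le> c" using g[of undefined] by linarith
  define A where "A S = (\<Sum>x\<in>UNIV. character S x *\<^sub>R a x)" for S
  define A' where "A' S = (\<Sum>x\<in>UNIV. character S x *\<^sub>R b x)" for S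
  have pars: "(\<Sum>S\<in>UNIV. (norm (A S))\<^sup>2) = N * N" "(\<Sum>S\<in>UNIV. (norm (A' S))\<^sup>2) = N * N"
    unfolding A_def A'_def parseval_vector by (simp_all add: a b N_def)
  have "(\<Sum>x\<in>UNIV. \<Sum>y\<in>UNIV. (\<Sum>S\<in>UNIV. g S * character S (xor_vec x y)) * (a x \<bullet> b y))
      = (\<Sum>x\<in>UNIV. \<Sum>y\<in>UNIV. \<Sum>S\<in>UNIV. g S * (character S x * (character S y * (a x \<bullet> b y))))"
    unfolding sum_distrib_right character_xor_vec by (intro sum.cong refl) simp
  also have "\<dots> = (\<Sum>x\<in>UNIV. \<Sum>S\<in>UNIV. \<Sum>y\<in>UNIV. g S * (character S x * (character S y * (a x \<bullet> b y))))"
    by (intro sum.cong refl sum.swap)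
  also have "\<dots> = (\<Sum>S\<in>UNIV. \<Sum>x\<in>UNIV. \<Sum>y\<in>UNIV. g S * (character S x * (character S y * (a x \<bullet> b y))))"
    by (rule sum.swap)
  also have "\<dots> = (\<Sum>S\<in>UNIV. g S * (A S \<bullet> A' S))"
    by (simp add: A_def A'_def inner_sum_sum sum_distrib_left mult_ac)
  \<comment> \<open>Bounding each inner product by half the sum of squares lets Parseval be applied
    to the two families separately.\<close>
  also have "\<dots> \<le> (\<Sum>S\<in>UNIV. c * (((norm (A S))\<^sup>2 + (norm (A' S))\<^sup>2) / 2))"
  proof (rule sum_mono)
    fix S
    have "g S * (A S \<bullet> A' S) \<le> \<bar>g S\<bar> * \<bar>A S \<bullet> A' S\<bar>"
      by (metis abs_ge_self abs_mult)
    also have "\<dots> \<le> c * \<bar>A S \<bullet> A' S\<bar>" by (intro mult_right_mono g) simp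
    also have "\<dots> \<le> c * (norm (A S) * norm (A' S))"
      by (intro mult_left_mono Cauchy_Schwarz_ineq2 c)
    also have "\<dots> \<le> c * (((norm (A S))\<^sup>2 + (norm (A' S))\<^sup>2) / 2)"
      using sum_squares_bound[of "norm (A S)" "norm (A' S)"] by (intro mult_left_mono c) auto
    finally show "g S * (A S \<bullet> A' S) \<le> c * (((norm (A S))\<^sup>2 + (norm (A' S))\<^sup>2) / 2)" .
  qed
  also have "\<dots> = c * (N * N)"
    by (simp add: sum_distrib_left[symmetric] sum_divide_distrib[symmetric] sum.distrib pars)
  finally show ?thesis by (simp add: N_def)
qed

section \<open>The lower bound\<close>

lemma ex_sign_rank:
  fixes M :: "real ^ 'c::finite ^ 'r::finite"
  obtains B where "\<And>i j. sgn (B $ i $ j) = sgn (M $ i $ j)" "rank B = sign_rank M"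
proof -
  have "\<exists>r. \<exists>B. (\<forall>i j. sgn (B $ i $ j) = sgn (M $ i $ j)) \<and> rank B = r" by blast
  from LeastI_ex[OF this] show thesis using that unfolding sign_rank_def by blast
qed

theorem mainTheorem8:
  fixes f :: "bool ^ 'n::finite \<Rightarrow> real"
    and \<S> :: "'n set set"
    and \<delta> c :: real
  assumes "\<forall>x. f x \<in> {-1, 1}"
    and "\<forall>S\<in>\<S>. fourier_coeff f S \<noteq> 0"
    and "(\<Sum>S\<in>\<S>. \<bar>fourier_coeff f S\<bar>) \<le> 1 - \<delta>"
    and "0 \<le> c"
    and "\<forall>S. S \<notin> \<S> \<longrightarrow> \<bar>fourier_coeff f S\<bar> \<le> c"
  shows "real (sign_rank (xor_matrix f)) \<ge> \<delta> / c"
proof (cases "0 < \<delta> \<and> 0 < c")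
  \<comment> \<open>This includes \<open>c = 0\<close>, where the quotient is 0 by the convention
    for division.\<close>
  case False
  then have "\<delta> / c \<le> 0" using assms(4) by (auto simp: divide_le_0_iff)
  then show ?thesis by (rule order_trans) simp
next
  case True
  then have \<delta>: "0 < \<delta>" and c: "0 < c" by auto
  define N :: real where "N = 2 ^ CARD('n)"
  have N: "0 < N" by (simp add: N_def)
  define g where "g S = (if S \<in> \<S> then 0 else fourier_coeff f S)" for S
  define h where "h z = (\<Sum>S\<in>UNIV. g S * character S z)" for z
  have f_sq: "f z * f z = 1" for z using assms(1)[rule_format, of z] by auto
  have f_sgn: "sgn (f z) = f z" for z using assms(1)[rule_format, of z] by auto
  have f_abs: "\<bar>f z\<bar> = 1" for z using assms(1)[rule_format, of z] by auto
  \<comment> \<open>As \<open>f z\<close> is a sign, \<open>f z * h z\<close> is 1 minus a signed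
    sum over \<open>\<S>\<close>, which the hypothesis bounds by
    \<open>1 - \<delta>\<close>.\<close>
  have fh: "\<delta> \<le> f z * h z" for z
  proof -
    have "f z = (\<Sum>S\<in>UNIV. g S * character S z
        + (if S \<in> \<S> then fourier_coeff f S * character S z else 0))"
      by (subst fourier_inversion) (auto intro!: sum.cong simp: g_def)
    then have "h z = f z - (\<Sum>S\<in>\<S>. fourier_coeff f S * character S z)"
      by (simp add: sum.distrib h_def sum.If_cases)
    then have "f z * h z = 1 - f z * (\<Sum>S\<in>\<S>. fourier_coeff f S * character S z)"
      by (simp add: right_diff_distrib f_sq)
    moreover have "\<bar>f z * (\<Sum>S\<in>\<S>. fourier_coeff f S * character S z)\<bar>
        \<le> (\<Sum>S\<in>\<S>. \<bar>fourier_coeff f S\<bar>)"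
      unfolding abs_mult f_abs
      using sum_abs[of "\<lambda>S. fourier_coeff f S * character S z" \<S>]
      by (simp add: abs_mult abs_character)
    ultimately show ?thesis using assms(3) by linarith
  qed
  obtain B where B: "\<And>x y. sgn (B $ x $ y) = sgn (xor_matrix f $ x $ y)"
    and rank: "rank B = sign_rank (xor_matrix f)"
    using ex_sign_rank[of "xor_matrix f"] by blast
  have sgB: "sgn (B $ x $ y) = f (xor_vec x y)" for x y
    by (simp add: B xor_matrix_def f_sgn)
  have B_nz: "B $ x $ y \<noteq> 0" for x y using sgB[of x y] f_sq[of "xor_vec x y"] by auto
  \<comment> \<open>The matrix \<open>B\<close> is fixed before \<eta>, so \<eta> can tend to 0
    while the rank stays put.\<close>
  have approx: "\<delta> * (1 - \<eta>) \<le> c * rank B" if \<eta>: "0 < \<eta>" for \<eta>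
  proof -
    obtain a b :: "_ \<Rightarrow> (real ^ (bool ^ 'n)) \<times> (real ^ (bool ^ 'n))"
      where a: "\<And>x. norm (a x) = 1" and b: "\<And>y. norm (b y) = 1"
        and sg: "\<And>x y. sgn (a x \<bullet> b y) = sgn (B $ x $ y)"
        and frame: "(1 - \<eta>) * (real CARD(bool ^ 'n) * real CARD(bool ^ 'n))
          \<le> real (rank B) * (\<Sum>x\<in>UNIV. \<Sum>y\<in>UNIV. (a x \<bullet> b y)\<^sup>2)"
      by (rule ex_unit_vectors_of_rank[OF B_nz \<eta>]) (rule that)
    let ?Q = "\<Sum>x\<in>UNIV. \<Sum>y\<in>UNIV. (a x \<bullet> b y)\<^sup>2"
    \<comment> \<open>The inner product \<open>t\<close> has the sign of \<open>f\<close>, so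
      multiplying it by \<open>h\<close> gives at least \<delta> times its modulus. Unit vectors
      give modulus at most 1, which passes to the square.\<close>
    have entry: "\<delta> * (a x \<bullet> b y)\<^sup>2 \<le> h (xor_vec x y) * (a x \<bullet> b y)" for x y
    proof -
      let ?t = "a x \<bullet> b y"
      have t: "?t = f (xor_vec x y) * \<bar>?t\<bar>" by (metis sg sgB mult_sgn_abs)
      have "\<bar>?t\<bar> \<le> 1" using Cauchy_Schwarz_ineq2[of "a x" "b y"] by (simp add: a b)
      then have "?t\<^sup>2 \<le> \<bar>?t\<bar>"
        using mult_left_mono[of "\<bar>?t\<bar>" 1 "\<bar>?t\<bar>"] by (simp add: power2_eq_square)
      then have "\<delta> * ?t\<^sup>2 \<le> \<delta> * \<bar>?t\<bar>" using \<delta> by simp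
      also have "\<dots> \<le> f (xor_vec x y) * h (xor_vec x y) * \<bar>?t\<bar>"
        by (intro mult_right_mono fh) simp
      also have "\<dots> = h (xor_vec x y) * (f (xor_vec x y) * \<bar>?t\<bar>)" by simp
      finally show ?thesis using t by simp
    qed
    have "\<delta> * ?Q \<le> (\<Sum>x\<in>UNIV. \<Sum>y\<in>UNIV. h (xor_vec x y) * (a x \<bullet> b y))"
      unfolding sum_distrib_left by (intro sum_mono entry)
    also have "\<dots> \<le> c * (N * N)"
      unfolding h_def N_def
      by (rule xor_pairing_le[OF a b]) (use assms(4,5) in \<open>auto simp: g_def\<close>)
    finally have Q: "\<delta> * ?Q \<le> c * (N * N)" .
    have "\<delta> * (1 - \<eta>) * (N * N) = \<delta> * ((1 - \<eta>) * (real CARD(bool ^ 'n) * real CARD(bool ^ 'n)))"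
      by (simp add: N_def)
    also have "\<dots> \<le> \<delta> * (rank B * ?Q)" using \<delta> by (intro mult_left_mono frame) simp
    also have "\<dots> = rank B * (\<delta> * ?Q)" by simp
    also have "\<dots> \<le> rank B * (c * (N * N))" by (intro mult_left_mono Q) simp
    finally have "\<delta> * (1 - \<eta>) * (N * N) \<le> c * rank B * (N * N)" by (simp add: mult_ac)
    then show ?thesis using N by simp
  qed
  have "\<delta> \<le> c * rank B"
  proof (rule field_le_epsilon)
    fix d :: real assume "0 < d"
    \<comment> \<open>Taking \<eta> to be \<open>d / \<delta>\<close> makes the loss exactly
      \<open>d\<close>.\<close>
    then have "\<delta> * (1 - d / \<delta>) \<le> c * rank B" by (intro approx) (simp add: \<delta>)
    moreover have "\<delta> * (1 - d / \<delta>) = \<delta> - d" using \<delta> by (simp add: right_diff_distrib)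
    ultimately show "\<delta> \<le> c * rank B + d" by linarith
  qed
  then show ?thesis using c by (simp add: rank field_simps)
qed

end
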